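(* Let $P$ and $Q$ be two probability distributions on the same measurable space. Then, for any real-valued random variable $X$ with finite expectations $E_P[X]$ and $E_Q[X]$, the following four inequalities hold: $$\frac{(E_P[X]-E_Q[X])^2}{2}\Big(\frac{1}{\mathrm{TV}(P,Q)}-1\Big)\leq \mathrm{Var}_P(X)+\mathrm{Var}_Q(X),$$ $$\frac{(E_P[X]-E_Q[X])^2}{4-2H^2(P,Q)}\Big(\frac{1}{H(P,Q)}-H(P,Q)\Big)^2\leq \mathrm{Var}_P(X)+\mathrm{Var}_Q(X),$$ $$(E_P[X]-E_Q[X])^2\Big(\frac{1}{\mathrm{KL}(P,Q)+\mathrm{KL}(Q,P)}-\frac14\Big)\leq \mathrm{Var}_P(X)\vee \mathrm{Var}_Q(X),$$ $$(E_P[X]-E_Q[X])^2\leq \big(\chi^2(Q,P)\,\mathrm{Var}_P(X)\big)\wedge\big(\chi^2(P,Q)\,\mathrm{Var}_Q(X)\big).$$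
   Context: Let $\nu$ be any measure dominating $P$ and $Q$ (e.g. $\nu=(P+Q)/2$) and let $p,q$ be the $\nu$-densities of $P,Q$. Define - total variation: $\mathrm{TV}(P,Q)=\frac12\int|p-q|\,d\nu$; - squared Hellinger distance: $H^2(P,Q)=H(P,Q)^2=\frac12\int(\sqrt p-\sqrt q)^2\,d\nu$, with $H(P,Q)\ge 0$; - Kullback-Leibler divergence: $\mathrm{KL}(P,Q)=\int \log(p/q)\,p\,d\nu$ if $P\ll Q$, and $+\infty$ otherwise; - $\chi^2$-divergence: $\chi^2(P,Q)=\int (p/q-1)^2q\,d\nu$ if $P\ll Q$, and $+\infty$ otherwise. $E_P,\mathrm{Var}_P$ denote expectation and variance under $P$. If $X$ is not square integrable under $P$, then $\mathrm{Var}_P(X):=+\infty$. Notation: $a\vee b=\max(a,b)$, $a\wedge b=\min(a,b)$. Conventions: if one of the information measures appearing in an inequality is zero, the left-hand side of the corresponding inequality is assigned the value zero; $1/(+\infty)=0$; $(+\infty)\cdot 0=+\infty$ in the last inequality. *)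

theory Defs
  imports "HOL-Probability.Probability"
begin

(* In the four divergences below, p and q are real-valued densities, with respect to a dominating
   measure N, of P = density N p and Q = density N q. *)

definition total_variation :: "'a measure \<Rightarrow> ('a \<Rightarrow> real) \<Rightarrow> ('a \<Rightarrow> real) \<Rightarrow> real" where
  "total_variation N p q = 1 / 2 * (\<integral>x. \<bar>p x - q x\<bar> \<partial>N)"

definition hellinger_sq :: "'a measure \<Rightarrow> ('a \<Rightarrow> real) \<Rightarrow> ('a \<Rightarrow> real) \<Rightarrow> real" where
  "hellinger_sq N p q = 1 / 2 * (\<integral>x. (sqrt (p x) - sqrt (q x))\<^sup>2 \<partial>N)"

definition hellinger :: "'a measure \<Rightarrow> ('a \<Rightarrow> real) \<Rightarrow> ('a \<Rightarrow> real) \<Rightarrow> real" where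
  "hellinger N p q = sqrt (hellinger_sq N p q)"

(* Lebesgue integral with values in the extended reals, as positive minus negative part; needed
   because the Bochner integral of a non-integrable function is 0.  Meaningful unless both parts
   are infinite. *)
definition ext_integral :: "'a measure \<Rightarrow> ('a \<Rightarrow> real) \<Rightarrow> ereal" where
  "ext_integral N f =
     enn2ereal (\<integral>\<^sup>+x. ennreal (f x) \<partial>N) - enn2ereal (\<integral>\<^sup>+x. ennreal (- f x) \<partial>N)"

(* absolutely_continuous Q P means P << Q.  The totalized values at p x = 0 agree with
   0 log 0 = 0, and p x > 0 = q x happens only on an N-null set when P << Q. *)
definition kl_divergence :: "'a measure \<Rightarrow> ('a \<Rightarrow> real) \<Rightarrow> ('a \<Rightarrow> real) \<Rightarrow> ereal" where
  "kl_divergence N p q =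
     (if absolutely_continuous (density N (\<lambda>x. ennreal (q x))) (density N (\<lambda>x. ennreal (p x)))
      then ext_integral N (\<lambda>x. ln (p x / q x) * p x) else \<infinity>)"

definition chi2_divergence :: "'a measure \<Rightarrow> ('a \<Rightarrow> real) \<Rightarrow> ('a \<Rightarrow> real) \<Rightarrow> ereal" where
  "chi2_divergence N p q =
     (if absolutely_continuous (density N (\<lambda>x. ennreal (q x))) (density N (\<lambda>x. ennreal (p x)))
      then ext_integral N (\<lambda>x. (p x / q x - 1)\<^sup>2 * q x) else \<infinity>)"

definition ext_variance :: "'a measure \<Rightarrow> ('a \<Rightarrow> real) \<Rightarrow> ereal" where
  "ext_variance P X =
     (if integrable P (\<lambda>x. (X x)\<^sup>2)
      then ereal (\<integral>x. (X x - (\<integral>y. X y \<partial>P))\<^sup>2 \<partial>P) else \<infinity>)"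

(* Multiplication with the convention that infinity times 0 is infinity. *)
definition times_top :: "ereal \<Rightarrow> ereal \<Rightarrow> ereal" where
  "times_top a b = (if a = \<infinity> \<and> b = 0 \<or> a = 0 \<and> b = \<infinity> then \<infinity> else a * b)"

(* A dominating measure with nonnegative real densities, as assumed in the definitions above,
   exists for any two probability measures on the same measurable space. *)
lemma dominating_densities_exist:
  assumes P: "prob_space P" and Q: "prob_space Q" and sets_eq: "sets Q = sets P"
  obtains N and p q :: "'a \<Rightarrow> real"
  where "p \<in> borel_measurable N" "q \<in> borel_measurable N"
    "\<And>x. 0 \<le> p x" "\<And>x. 0 \<le> q x" "P = density N (\<lambda>x. ennreal (p x))" "Q = density N (\<lambda>x. ennreal (q x))"
proof -
  interpret P: prob_space P by fact
  interpret Q: prob_space Q by fact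
  define N where "N = measure_of (space P) (sets P) (\<lambda>A. emeasure P A + emeasure Q A)"
  have sN: "sets N = sets P" "space N = space P"
    by (simp_all add: N_def)
  have eN: "emeasure N A = emeasure P A + emeasure Q A" if "A \<in> sets P" for A
    unfolding N_def
  proof (rule emeasure_measure_of_sigma[OF sets.sigma_algebra_axioms _ _ that])
    show "positive (sets P) (\<lambda>A. emeasure P A + emeasure Q A)"
      by (simp add: positive_def)
    show "countably_additive (sets P) (\<lambda>A. emeasure P A + emeasure Q A)"
    proof (rule countably_additiveI)
      fix A :: "nat \<Rightarrow> 'a set"
      assume A: "range A \<subseteq> sets P" "disjoint_family A"
      have "(\<Sum>i. emeasure P (A i) + emeasure Q (A i)) =
          (\<Sum>i. emeasure P (A i)) + (\<Sum>i. emeasure Q (A i))"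
        by (intro suminf_add[symmetric] summableI)
      then show "(\<Sum>i. emeasure P (A i) + emeasure Q (A i)) =
          emeasure P (\<Union>i. A i) + emeasure Q (\<Union>i. A i)"
        using A sets_eq by (simp add: suminf_emeasure)
    qed
  qed
  interpret N: finite_measure N
    by (rule finite_measureI) (simp add: sN eN P.emeasure_space_1 Q.emeasure_eq_measure)
  have acP: "absolutely_continuous N P" and acQ: "absolutely_continuous N Q"
    using sets_eq by (auto simp: absolutely_continuous_def null_sets_def sN eN)
  have *: "\<exists>f :: 'a \<Rightarrow> real. f \<in> borel_measurable N \<and> (\<forall>x. 0 \<le> f x) \<and> M = density N (\<lambda>x. ennreal (f x))"
    if M: "finite_measure M" "absolutely_continuous N M" "sets M = sets N" for M
  proof -
    obtain D where D: "D \<in> borel_measurable N" "AE x in N. RN_deriv N M x = ennreal (D x)"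
      "\<And>x. 0 \<le> D x"
      using N.real_RN_deriv[OF M] by metis
    have "M = density N (RN_deriv N M)"
      using N.density_RN_deriv[OF M(2,3)] by simp
    also have "\<dots> = density N (\<lambda>x. ennreal (D x))"
      using D by (intro density_cong) auto
    finally show ?thesis using D(1,3) by blast
  qed
  obtain p where "p \<in> borel_measurable N" "\<forall>x. 0 \<le> p x" "P = density N (\<lambda>x. ennreal (p x))"
    using *[OF P.finite_measure_axioms acP] sN by metis
  moreover obtain q where "q \<in> borel_measurable N" "\<forall>x. 0 \<le> q x" "Q = density N (\<lambda>x. ennreal (q x))"
    using *[OF Q.finite_measure_axioms acQ] sN sets_eq by metis
  ultimately show ?thesis
    by (intro that[of p N q]) blast+
qed

end

theory Submission
  imports Defs
begin

text \<open>The first three inequalities all pass through the triangular discrimination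
  \<open>\<Delta> = \<integral> (p - q)\<^sup>2 / (p + q) d\<nu>\<close>. Centring \<open>X\<close> at the midpoint of its two means and applying
  Cauchy--Schwarz to \<open>(X - m) \<surd>(p + q)\<close> and \<open>(p - q) / \<surd>(p + q)\<close> gives
  \<open>d\<^sup>2 \<le> \<Delta> (Var P X + Var Q X + d\<^sup>2 / 2)\<close> for the difference \<open>d\<close> of the means. It remains to bound
  \<open>\<Delta> \<le> 2 TV\<close>, \<open>\<Delta> \<le> 2 H\<^sup>2 (2 - H\<^sup>2)\<close> and \<open>2 \<Delta> \<le> KL(P,Q) + KL(Q,P)\<close>, the last one by
  \<open>ln t \<ge> 2 (t - 1) / (t + 1)\<close> for \<open>t \<ge> 1\<close>. The chi-square bound is Cauchy--Schwarz for
  \<open>p / q - 1\<close> and \<open>X - E\<^sub>Q X\<close> under \<open>Q\<close>.\<close>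

section \<open>Preliminaries: Cauchy--Schwarz, extended integrals, variances, a logarithmic
  inequality\<close>

lemma integrable_mult_squares:
  fixes f g :: "'a \<Rightarrow> real"
  assumes [measurable]: "f \<in> borel_measurable M" "g \<in> borel_measurable M"
    and "integrable M (\<lambda>x. (f x)\<^sup>2)" "integrable M (\<lambda>x. (g x)\<^sup>2)"
  shows "integrable M (\<lambda>x. f x * g x)"
proof (rule Bochner_Integration.integrable_bound)
  show "integrable M (\<lambda>x. (f x)\<^sup>2 + (g x)\<^sup>2)"
    using assms by simp
  have "\<bar>f x * g x\<bar> \<le> (f x)\<^sup>2 + (g x)\<^sup>2" for x
    using sum_squares_bound[of "\<bar>f x\<bar>" "\<bar>g x\<bar>"]
      mult_nonneg_nonneg[OF abs_ge_zero abs_ge_zero, of "f x" "g x"]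
    unfolding abs_mult power2_abs by linarith
  then show "AE x in M. norm (f x * g x) \<le> norm ((f x)\<^sup>2 + (g x)\<^sup>2)"
    by simp
qed simp

text \<open>The integral of \<open>(f - t g)^2\<close> is a nonnegative quadratic in
  \<open>t\<close>; evaluating it at its minimiser \<open>t = B / C\<close> gives the bound when
  \<open>C > 0\<close>.\<close>

lemma integral_Cauchy_Schwarz:
  fixes f g :: "'a \<Rightarrow> real"
  assumes [measurable]: "f \<in> borel_measurable M" "g \<in> borel_measurable M"
    and f: "integrable M (\<lambda>x. (f x)\<^sup>2)" and g: "integrable M (\<lambda>x. (g x)\<^sup>2)"
  shows "(\<integral>x. f x * g x \<partial>M)\<^sup>2 \<le> (\<integral>x. (f x)\<^sup>2 \<partial>M) * (\<integral>x. (g x)\<^sup>2 \<partial>M)"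
proof -
  define A B C where "A = (\<integral>x. (f x)\<^sup>2 \<partial>M)" and "B = (\<integral>x. f x * g x \<partial>M)"
    and "C = (\<integral>x. (g x)\<^sup>2 \<partial>M)"
  have fg: "integrable M (\<lambda>x. f x * g x)"
    using assms by (rule integrable_mult_squares)
  have quad: "0 \<le> A - 2 * t * B + t\<^sup>2 * C" for t
  proof -
    have "0 \<le> (\<integral>x. (f x - t * g x)\<^sup>2 \<partial>M)"
      by simp
    also have "\<dots> = (\<integral>x. (f x)\<^sup>2 - 2 * t * (f x * g x) + t\<^sup>2 * (g x)\<^sup>2 \<partial>M)"
      by (intro Bochner_Integration.integral_cong) (auto simp: power2_eq_square algebra_simps)
    also have "\<dots> = A - 2 * t * B + t\<^sup>2 * C"
      using f g fg by (simp add: A_def B_def C_def)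
    finally show ?thesis .
  qed
  have "C \<ge> 0"
    by (simp add: C_def)
  show ?thesis unfolding A_def[symmetric] B_def[symmetric] C_def[symmetric]
  proof (cases "C = 0")
    case True
    \<comment> \<open>For \<open>C = 0\<close> the expression is affine in \<open>t\<close>. If
      \<open>B\<close> were nonzero, the chosen \<open>t\<close> would give it the value -1.\<close>
    then have "B = 0"
      using quad[of "(A + 1) / (2 * B)"] by (cases "B = 0") auto
    then show "B\<^sup>2 \<le> A * C"
      using True by simp
  next
    case False
    then have "C > 0"
      using \<open>C \<ge> 0\<close> by simp
    then show "B\<^sup>2 \<le> A * C"
      using quad[of "B / C"] by (simp add: field_simps power2_eq_square)
  qed
qed

text \<open>With a finite negative part, an infinite positive part would make the difference
  infinite. Hence both parts are finite and the extended integral is the Bochner integral.\<close>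

lemma ext_integral_finite:
  assumes [measurable]: "f \<in> borel_measurable N"
    and neg: "(\<integral>\<^sup>+x. ennreal (- f x) \<partial>N) \<noteq> \<infinity>" and fin: "ext_integral N f \<noteq> \<infinity>"
  shows "integrable N f" and "ext_integral N f = ereal (\<integral>x. f x \<partial>N)"
proof -
  have pos: "(\<integral>\<^sup>+x. ennreal (f x) \<partial>N) \<noteq> \<infinity>"
  proof
    assume top: "(\<integral>\<^sup>+x. ennreal (f x) \<partial>N) = \<infinity>"
    obtain b where "(\<integral>\<^sup>+x. ennreal (- f x) \<partial>N) = ennreal b" "0 \<le> b"
      using neg by (metis ennreal_cases infinity_ennreal_def)
    then show False
      using fin top by (simp add: ext_integral_def enn2ereal_ennreal)
  qed
  show int: "integrable N f"
    using pos neg by (simp add: real_integrable_def)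
  obtain a b where "(\<integral>\<^sup>+x. ennreal (f x) \<partial>N) = ennreal a" "0 \<le> a"
    "(\<integral>\<^sup>+x. ennreal (- f x) \<partial>N) = ennreal b" "0 \<le> b"
    using pos neg by (metis ennreal_cases infinity_ennreal_def)
  then show "ext_integral N f = ereal (\<integral>x. f x \<partial>N)"
    using int by (simp add: ext_integral_def real_lebesgue_integral_def enn2ereal_ennreal)
qed

text \<open>A finite \<open>ext_variance\<close> encodes square integrability, so the second moment
  about any centre is the variance plus a squared bias. The centre \<open>c\<close> stays free:
  later it is the midpoint of the two means for the triangular bound and the mean under
  \<open>Q\<close> for the chi-square bound.\<close>

lemma (in prob_space) ext_variance_finite_imp:
  fixes X :: "'a \<Rightarrow> real"
  assumes "integrable M X" "ext_variance M X \<noteq> \<infinity>"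
  shows "integrable M (\<lambda>x. (X x - c)\<^sup>2)"
    and "ext_variance M X = ereal (expectation (\<lambda>x. (X x - c)\<^sup>2) - (expectation X - c)\<^sup>2)"
proof -
  have sq: "integrable M (\<lambda>x. (X x)\<^sup>2)"
    using assms(2) by (auto simp: ext_variance_def split: if_splits)
  have int: "integrable M (\<lambda>x. (X x)\<^sup>2 - 2 * c * X x + c\<^sup>2)"
    using assms sq by simp
  have eq: "(\<lambda>x. (X x - c)\<^sup>2) = (\<lambda>x. (X x)\<^sup>2 - 2 * c * X x + c\<^sup>2)"
    by (auto simp: power2_eq_square algebra_simps)
  show "integrable M (\<lambda>x. (X x - c)\<^sup>2)"
    unfolding eq by (rule int)
  show "ext_variance M X = ereal (expectation (\<lambda>x. (X x - c)\<^sup>2) - (expectation X - c)\<^sup>2)"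
    unfolding eq using assms(1) sq
    by (simp add: ext_variance_def variance_eq prob_space power2_eq_square algebra_simps)
qed

lemma ext_variance_nonneg: "0 \<le> ext_variance P X"
  by (simp add: ext_variance_def)

text \<open>For \<open>u < v\<close>, convexity of \<open>1 / t\<close> bounds its integral over
  \<open>[u, v]\<close> below by the midpoint-rule value \<open>2 (v - u) / (u + v)\<close>;
  multiplying by \<open>v - u\<close> gives \<open>*\<close>. Both sides are symmetric in
  \<open>a\<close> and \<open>b\<close>, so either order reduces to this.\<close>

lemma log_ratio_ge:
  fixes a b :: real
  assumes "0 < a" "0 < b"
  shows "2 * ((a - b)\<^sup>2 / (a + b)) \<le> (a - b) * ln (a / b)"
proof -
  have *: "2 * ((v - u)\<^sup>2 / (v + u)) \<le> (v - u) * (ln v - ln u)" if "0 < u" "u < v" for u v :: real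
    using mult_left_mono[OF ln_inverse_approx_ge[OF that], of "v - u"] that
    by (simp add: power2_eq_square field_simps)
  consider "a < b" | "a = b" | "b < a"
    by linarith
  then show ?thesis
  proof cases
    case 1
    then show ?thesis
      using *[of a b] assms by (simp add: ln_div power2_commute[of b a] algebra_simps)
  next
    case 3
    then show ?thesis
      using *[of b a] assms by (simp add: ln_div)
  qed auto
qed

section \<open>A pair of probability densities\<close>

locale density_pair =
  fixes N :: "'a measure" and p q :: "'a \<Rightarrow> real"
  assumes p_meas [measurable]: "p \<in> borel_measurable N"
    and q_meas [measurable]: "q \<in> borel_measurable N"
    and p_nonneg: "\<And>x. x \<in> space N \<Longrightarrow> 0 \<le> p x"
    and q_nonneg: "\<And>x. x \<in> space N \<Longrightarrow> 0 \<le> q x"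
    and P_prob: "prob_space (density N (\<lambda>x. ennreal (p x)))"
    and Q_prob: "prob_space (density N (\<lambda>x. ennreal (q x)))"
begin

abbreviation P :: "'a measure" where "P \<equiv> density N (\<lambda>x. ennreal (p x))"
abbreviation Q :: "'a measure" where "Q \<equiv> density N (\<lambda>x. ennreal (q x))"

text \<open>The assumptions are symmetric in \<open>p\<close> and \<open>q\<close>, so each fact
  about \<open>P\<close> yields its counterpart for \<open>Q\<close> by instantiation.\<close>

lemma swap: "density_pair N q p"
  using p_nonneg q_nonneg P_prob Q_prob by (intro density_pair.intro p_meas q_meas)

text \<open>Where \<open>p\<close> and \<open>q\<close> both vanish, the totalized quotient is 0, so
  such points contribute nothing.\<close>

definition triangular :: real where
  "triangular = (\<integral>x. (p x - q x)\<^sup>2 / (p x + q x) \<partial>N)"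

lemma integrable_P_iff:
  fixes f :: "'a \<Rightarrow> real"
  assumes "f \<in> borel_measurable N"
  shows "integrable P f \<longleftrightarrow> integrable N (\<lambda>x. p x * f x)"
  using assms p_nonneg by (simp add: integrable_density)

lemma integral_P:
  fixes f :: "'a \<Rightarrow> real"
  assumes "f \<in> borel_measurable N"
  shows "(\<integral>x. f x \<partial>P) = (\<integral>x. p x * f x \<partial>N)"
  using assms p_nonneg by (simp add: integral_density)

lemma integrable_p: "integrable N p" and integral_p: "(\<integral>x. p x \<partial>N) = 1"
proof -
  interpret prob_space P by (rule P_prob)
  show "integrable N p"
    using integrable_P_iff[of "\<lambda>_. 1"] by simp
  show "(\<integral>x. p x \<partial>N) = 1"
    using integral_P[of "\<lambda>_. 1"] prob_space by simp
qed

lemmas integrable_Q_iff = density_pair.integrable_P_iff[OF swap]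
lemmas integral_Q = density_pair.integral_P[OF swap]
lemmas integrable_q = density_pair.integrable_p[OF swap]
lemmas integral_q = density_pair.integral_p[OF swap]

section \<open>Triangular discrimination against total variation and Hellinger distance\<close>

lemma triangular_pointwise_le:
  assumes "x \<in> space N"
  shows "(p x - q x)\<^sup>2 / (p x + q x) \<le> \<bar>p x - q x\<bar>"
proof -
  have "\<bar>p x - q x\<bar> * \<bar>p x - q x\<bar> \<le> \<bar>p x - q x\<bar> * (p x + q x)"
    using p_nonneg[OF assms] q_nonneg[OF assms] by (intro mult_left_mono) auto
  then show ?thesis
    using p_nonneg[OF assms] q_nonneg[OF assms]
    by (cases "p x + q x = 0") (auto simp: field_simps power2_eq_square)
qed

lemma integrable_triangular: "integrable N (\<lambda>x. (p x - q x)\<^sup>2 / (p x + q x))"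
proof (rule Bochner_Integration.integrable_bound)
  show "integrable N (\<lambda>x. p x - q x)"
    using integrable_p integrable_q by simp
  show "AE x in N. norm ((p x - q x)\<^sup>2 / (p x + q x)) \<le> norm (p x - q x)"
    using triangular_pointwise_le p_nonneg q_nonneg by (intro AE_I2) (auto simp: abs_of_nonneg)
qed simp

lemma triangular_nonneg: "0 \<le> triangular"
  unfolding triangular_def using p_nonneg q_nonneg
  by (intro Bochner_Integration.integral_nonneg) auto

lemma triangular_le_TV: "triangular \<le> 2 * total_variation N p q"
proof -
  have "triangular \<le> (\<integral>x. \<bar>p x - q x\<bar> \<partial>N)"
    unfolding triangular_def using integrable_triangular integrable_p integrable_q
    by (intro integral_mono) (auto simp: triangular_pointwise_le)
  then show ?thesis
    by (simp add: total_variation_def)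
qed

text \<open>Since \<open>p\<close> and \<open>q\<close> integrate to 1, expanding the square leaves
  1 minus the Hellinger affinity. The affinity is nonnegative, whence the upper bound.\<close>

lemma
  shows hellinger_sq_eq: "hellinger_sq N p q = 1 - (\<integral>x. sqrt (p x) * sqrt (q x) \<partial>N)"
    and hellinger_sq_le_1: "hellinger_sq N p q \<le> 1"
    and hellinger_sq_nonneg: "0 \<le> hellinger_sq N p q"
proof -
  have int: "integrable N (\<lambda>x. sqrt (p x) * sqrt (q x))"
    using p_nonneg q_nonneg integrable_p integrable_q
    by (intro integrable_mult_squares) (auto cong: Bochner_Integration.integrable_cong)
  have "(\<integral>x. (sqrt (p x) - sqrt (q x))\<^sup>2 \<partial>N) = (\<integral>x. p x + q x - 2 * (sqrt (p x) * sqrt (q x)) \<partial>N)"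
    using p_nonneg q_nonneg
    by (intro Bochner_Integration.integral_cong) (auto simp: power2_diff)
  also have "\<dots> = 2 - 2 * (\<integral>x. sqrt (p x) * sqrt (q x) \<partial>N)"
    using integrable_p integrable_q int by (simp add: integral_p integral_q)
  finally show eq: "hellinger_sq N p q = 1 - (\<integral>x. sqrt (p x) * sqrt (q x) \<partial>N)"
    by (simp add: hellinger_sq_def)
  show "hellinger_sq N p q \<le> 1"
    unfolding eq using p_nonneg q_nonneg by (auto intro!: Bochner_Integration.integral_nonneg)
  show "0 \<le> hellinger_sq N p q"
    by (simp add: hellinger_sq_def)
qed

text \<open>Cauchy--Schwarz bounds the squared Hellinger affinity by \<open>2 \<integral> p q / (p + q) d\<nu>\<close>,
  since \<open>(p - q)\<^sup>2 / (p + q) = p + q - 4 p q / (p + q)\<close>.\<close>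

lemma triangular_le_hellinger:
  "triangular \<le> 2 * hellinger_sq N p q * (2 - hellinger_sq N p q)"
proof -
  define h where "h x = p x * q x / (p x + q x)" for x
  have [measurable]: "h \<in> borel_measurable N"
    unfolding h_def by measurable
  have nn: "0 \<le> h x" if "x \<in> space N" for x
    using p_nonneg[OF that] q_nonneg[OF that] by (simp add: h_def)
  have tri: "(p x - q x)\<^sup>2 / (p x + q x) = p x + q x - 4 * h x" if "x \<in> space N" for x
    using p_nonneg[OF that] q_nonneg[OF that]
    by (cases "p x + q x = 0") (auto simp: h_def field_simps power2_eq_square)
  have h_int: "integrable N h"
  proof (rule Bochner_Integration.integrable_bound)
    show "integrable N (\<lambda>x. p x + q x)"
      using integrable_p integrable_q by simp
    show "AE x in N. norm (h x) \<le> norm (p x + q x)"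
    proof (rule AE_I2)
      fix x assume x: "x \<in> space N"
      \<comment> \<open>By \<open>tri\<close> this says that \<open>4 * h x\<close> is at most
        \<open>p x + q x\<close>, which dominates \<open>h\<close>.\<close>
      have "0 \<le> (p x - q x)\<^sup>2 / (p x + q x)"
        using p_nonneg[OF x] q_nonneg[OF x] by simp
      then show "norm (h x) \<le> norm (p x + q x)"
        using nn[OF x] tri[OF x] by simp
    qed
  qed simp
  have T: "triangular = 2 - 4 * (\<integral>x. h x \<partial>N)"
  proof -
    have "triangular = (\<integral>x. p x + q x - 4 * h x \<partial>N)"
      unfolding triangular_def by (intro Bochner_Integration.integral_cong) (auto simp: tri)
    then show ?thesis
      using integrable_p integrable_q h_int by (simp add: integral_p integral_q)
  qed
  have "(\<integral>x. sqrt (p x) * sqrt (q x) \<partial>N)\<^sup>2 = (\<integral>x. sqrt (h x) * sqrt (p x + q x) \<partial>N)\<^sup>2"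
  proof (intro arg_cong[where f = "\<lambda>t. t\<^sup>2"] Bochner_Integration.integral_cong refl)
    fix x assume x: "x \<in> space N"
    \<comment> \<open>The factorization \<open>p q = h (p + q)\<close> also holds where
      \<open>p + q = 0\<close>, since both densities vanish there.\<close>
    show "sqrt (p x) * sqrt (q x) = sqrt (h x) * sqrt (p x + q x)"
      using p_nonneg[OF x] q_nonneg[OF x]
      by (cases "p x + q x = 0") (auto simp: h_def real_sqrt_mult[symmetric] add_nonneg_eq_0_iff)
  qed
  also have "\<dots> \<le> (\<integral>x. (sqrt (h x))\<^sup>2 \<partial>N) * (\<integral>x. (sqrt (p x + q x))\<^sup>2 \<partial>N)"
    using nn p_nonneg q_nonneg h_int integrable_p integrable_q
    by (intro integral_Cauchy_Schwarz) (auto cong: Bochner_Integration.integrable_cong)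
  also have "\<dots> = (\<integral>x. h x \<partial>N) * 2"
  proof -
    have "(\<integral>x. (sqrt (h x))\<^sup>2 \<partial>N) = (\<integral>x. h x \<partial>N)"
      by (intro Bochner_Integration.integral_cong) (auto simp: nn)
    moreover have "(\<integral>x. (sqrt (p x + q x))\<^sup>2 \<partial>N) = (\<integral>x. p x + q x \<partial>N)"
      by (intro Bochner_Integration.integral_cong) (auto simp: p_nonneg q_nonneg)
    ultimately show ?thesis
      using integrable_p integrable_q by (simp add: integral_p integral_q)
  qed
  finally have "(1 - hellinger_sq N p q)\<^sup>2 \<le> (\<integral>x. h x \<partial>N) * 2"
    by (simp add: hellinger_sq_eq)
  \<comment> \<open>With \<open>H2\<close> for the squared Hellinger distance,
    \<open>triangular\<close> is at most \<open>2 - 2 (1 - H2)^2\<close>, which equals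
    \<open>2 H2 (2 - H2)\<close>.\<close>
  then show ?thesis
    by (simp add: T power2_eq_square algebra_simps)
qed

section \<open>Finite Kullback--Leibler and chi-square divergences\<close>

lemma AE_absolutely_continuous:
  assumes "absolutely_continuous Q P"
  shows "AE x in N. q x = 0 \<longrightarrow> p x = 0"
proof -
  \<comment> \<open>Absolute continuity is tested on the zero set of \<open>q\<close>.\<close>
  have "{x \<in> space N. q x = 0} \<in> null_sets Q"
    by (subst null_sets_density_iff) auto
  then have "{x \<in> space N. q x = 0} \<in> null_sets P"
    using assms by (auto simp: absolutely_continuous_def)
  then have "AE x in N. x \<in> {x \<in> space N. q x = 0} \<longrightarrow> ennreal (p x) = 0"
    by (subst (asm) null_sets_density_iff) auto
  then show ?thesis
    using AE_space by eventually_elim (use p_nonneg in \<open>auto simp: ennreal_eq_0_iff antisym\<close>)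
qed

text \<open>The negative part of the integrand is dominated by \<open>q\<close>, because
  \<open>ln t \<le> t\<close> at \<open>t = q / p\<close>. It therefore has a finite integral, and a
  divergence other than infinity must come from an integrable function.\<close>

lemma kl_finite:
  assumes "kl_divergence N p q \<noteq> \<infinity>"
  shows "absolutely_continuous Q P" and "integrable N (\<lambda>x. ln (p x / q x) * p x)"
    and "kl_divergence N p q = ereal (\<integral>x. ln (p x / q x) * p x \<partial>N)"
proof -
  show ac: "absolutely_continuous Q P"
    using assms by (auto simp: kl_divergence_def split: if_splits)
  have "AE x in N. - (ln (p x / q x) * p x) \<le> q x"
    using AE_absolutely_continuous[OF ac] AE_space
  proof eventually_elim
    case (elim x)
    show ?case
    proof (cases "p x = 0")
      case True
      then show ?thesis using q_nonneg elim by simp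
    next
      case False
      then have pos: "0 < p x" "0 < q x"
        using elim p_nonneg[of x] q_nonneg[of x] by auto
      have "- ln (p x / q x) = ln (q x / p x)"
        using pos by (simp add: ln_div)
      also have "\<dots> \<le> q x / p x"
        using pos by (intro ln_bound) simp
      finally have "- ln (p x / q x) * p x \<le> q x / p x * p x"
        using pos by (intro mult_right_mono) auto
      then show ?thesis using pos by simp
    qed
  qed
  then have "(\<integral>\<^sup>+x. ennreal (- (ln (p x / q x) * p x)) \<partial>N) \<le> (\<integral>\<^sup>+x. ennreal (q x) \<partial>N)"
    by (intro nn_integral_mono_AE) (auto intro: ennreal_leI)
  also have "\<dots> < \<infinity>"
    using integrable_q q_nonneg by (subst nn_integral_eq_integral) auto
  finally have neg: "(\<integral>\<^sup>+x. ennreal (- (ln (p x / q x) * p x)) \<partial>N) \<noteq> \<infinity>"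
    by simp
  have eq: "kl_divergence N p q = ext_integral N (\<lambda>x. ln (p x / q x) * p x)"
    using ac by (simp add: kl_divergence_def)
  show "integrable N (\<lambda>x. ln (p x / q x) * p x)"
    using neg assms unfolding eq by (intro ext_integral_finite) auto
  show "kl_divergence N p q = ereal (\<integral>x. ln (p x / q x) * p x \<partial>N)"
    using neg assms unfolding eq by (intro ext_integral_finite) auto
qed

text \<open>The integrand is nonnegative, so its negative part integrates to 0 and
  \<open>ext_integral_finite\<close> applies.\<close>

lemma chi2_finite:
  assumes "chi2_divergence N p q \<noteq> \<infinity>"
  shows "absolutely_continuous Q P" and "integrable N (\<lambda>x. (p x / q x - 1)\<^sup>2 * q x)"
    and "chi2_divergence N p q = ereal (\<integral>x. (p x / q x - 1)\<^sup>2 * q x \<partial>N)"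
proof -
  show ac: "absolutely_continuous Q P"
    using assms by (auto simp: chi2_divergence_def split: if_splits)
  have "(\<integral>\<^sup>+x. ennreal (- ((p x / q x - 1)\<^sup>2 * q x)) \<partial>N) = (\<integral>\<^sup>+x. 0 \<partial>N)"
    using q_nonneg by (intro nn_integral_cong) (auto simp: ennreal_eq_0_iff)
  then have neg: "(\<integral>\<^sup>+x. ennreal (- ((p x / q x - 1)\<^sup>2 * q x)) \<partial>N) \<noteq> \<infinity>"
    by simp
  have eq: "chi2_divergence N p q = ext_integral N (\<lambda>x. (p x / q x - 1)\<^sup>2 * q x)"
    using ac by (simp add: chi2_divergence_def)
  show "integrable N (\<lambda>x. (p x / q x - 1)\<^sup>2 * q x)"
    using neg assms unfolding eq by (intro ext_integral_finite) auto
  show "chi2_divergence N p q = ereal (\<integral>x. (p x / q x - 1)\<^sup>2 * q x \<partial>N)"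
    using neg assms unfolding eq by (intro ext_integral_finite) auto
qed

lemma chi2_nonneg: "0 \<le> chi2_divergence N p q"
proof (cases "chi2_divergence N p q = \<infinity>")
  case False
  then show ?thesis
    using q_nonneg chi2_finite(3) by (auto intro!: Bochner_Integration.integral_nonneg)
qed simp

text \<open>The two integrands add up to \<open>(p - q) ln (p / q)\<close> where both densities are
  positive, so \<open>log_ratio_ge\<close> applies pointwise. Finiteness of both divergences gives
  absolute continuity both ways: almost everywhere the densities vanish together, and there both
  sides are 0.\<close>

lemma jeffreys_ge_triangular:
  assumes "kl_divergence N p q \<noteq> \<infinity>" "kl_divergence N q p \<noteq> \<infinity>"
  obtains j where "kl_divergence N p q + kl_divergence N q p = ereal j" "2 * triangular \<le> j"
proof -
  note pq = kl_finite[OF assms(1)]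
  note qp = density_pair.kl_finite[OF swap assms(2)]
  have "2 * triangular = (\<integral>x. 2 * ((p x - q x)\<^sup>2 / (p x + q x)) \<partial>N)"
    by (simp add: triangular_def del: times_divide_eq_right)
  also have "\<dots> \<le> (\<integral>x. ln (p x / q x) * p x + ln (q x / p x) * q x \<partial>N)"
  proof (rule integral_mono_AE)
    show "AE x in N. 2 * ((p x - q x)\<^sup>2 / (p x + q x))
        \<le> ln (p x / q x) * p x + ln (q x / p x) * q x"
      using AE_absolutely_continuous[OF pq(1)]
        density_pair.AE_absolutely_continuous[OF swap qp(1)] AE_space
    proof eventually_elim
      case (elim x)
      show ?case
      proof (cases "p x = 0")
        case False
        then have "0 < p x" "0 < q x"
          using elim p_nonneg[of x] q_nonneg[of x] by auto
        then show ?thesis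
          using log_ratio_ge[of "p x" "q x"] by (simp add: ln_div algebra_simps)
      qed (use elim in auto)
    qed
  qed (use pq qp in \<open>auto simp del: times_divide_eq_right intro: integrable_mult_right integrable_triangular\<close>)
  also have "\<dots> = (\<integral>x. ln (p x / q x) * p x \<partial>N) + (\<integral>x. ln (q x / p x) * q x \<partial>N)"
    using pq qp by simp
  finally show ?thesis
    using that pq(3) qp(3) by simp
qed

section \<open>Bounds on the difference of the means by Cauchy--Schwarz\<close>

lemma mean_diff_sq_le_triangular:
  fixes X :: "'a \<Rightarrow> real"
  assumes [measurable]: "X \<in> borel_measurable N"
    and X: "integrable P X" "integrable Q X"
    and vP: "ext_variance P X = ereal vP" and vQ: "ext_variance Q X = ereal vQ"
    and d: "d = (\<integral>x. X x \<partial>P) - (\<integral>x. X x \<partial>Q)"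
  shows "d\<^sup>2 \<le> triangular * (vP + vQ + d\<^sup>2 / 2)"
proof -
  \<comment> \<open>The midpoint is at distance \<open>d / 2\<close> from either mean, so the two
    squared biases add up to \<open>d^2 / 2\<close>.\<close>
  define m where "m = ((\<integral>x. X x \<partial>P) + (\<integral>x. X x \<partial>Q)) / 2"
  define Y where "Y x = X x - m" for x
  have [measurable]: "Y \<in> borel_measurable N"
    unfolding Y_def by measurable
  interpret P: prob_space P by (rule P_prob)
  interpret Q: prob_space Q by (rule Q_prob)
  have prob_one: "P.prob (space N) = 1" "Q.prob (space N) = 1"
    using P.prob_space Q.prob_space by simp_all
  have Y2: "integrable P (\<lambda>x. (Y x)\<^sup>2)" "integrable Q (\<lambda>x. (Y x)\<^sup>2)"
    unfolding Y_def using P.ext_variance_finite_imp(1)[OF X(1)] Q.ext_variance_finite_imp(1)[OF X(2)]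
    by (auto simp: vP vQ)
  have "vP = (\<integral>x. (Y x)\<^sup>2 \<partial>P) - ((\<integral>x. X x \<partial>P) - m)\<^sup>2"
    using P.ext_variance_finite_imp(2)[OF X(1), of m] by (simp add: vP Y_def)
  moreover have "(\<integral>x. X x \<partial>P) - m = d / 2"
    by (simp add: m_def d field_simps)
  ultimately have EP: "(\<integral>x. (Y x)\<^sup>2 \<partial>P) = vP + d\<^sup>2 / 4"
    by (simp add: power2_eq_square)
  have "vQ = (\<integral>x. (Y x)\<^sup>2 \<partial>Q) - ((\<integral>x. X x \<partial>Q) - m)\<^sup>2"
    using Q.ext_variance_finite_imp(2)[OF X(2), of m] by (simp add: vQ Y_def)
  moreover have "(\<integral>x. X x \<partial>Q) - m = - (d / 2)"
    by (simp add: m_def d field_simps)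
  ultimately have EQ: "(\<integral>x. (Y x)\<^sup>2 \<partial>Q) = vQ + d\<^sup>2 / 4"
    by (simp add: power2_eq_square)
  have YP: "integrable N (\<lambda>x. p x * Y x)" and YQ: "integrable N (\<lambda>x. q x * Y x)"
    using X by (simp_all add: Y_def flip: integrable_P_iff integrable_Q_iff)
  have Y2P: "integrable N (\<lambda>x. p x * (Y x)\<^sup>2)" and Y2Q: "integrable N (\<lambda>x. q x * (Y x)\<^sup>2)"
    using Y2 by (simp_all flip: integrable_P_iff integrable_Q_iff)
  define f where "f x = Y x * sqrt (p x + q x)" for x
  define g where "g x = (p x - q x) / sqrt (p x + q x)" for x
  have [measurable]: "f \<in> borel_measurable N" "g \<in> borel_measurable N"
    unfolding f_def g_def by measurable
  have f2: "(f x)\<^sup>2 = p x * (Y x)\<^sup>2 + q x * (Y x)\<^sup>2"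
    and g2: "(g x)\<^sup>2 = (p x - q x)\<^sup>2 / (p x + q x)" if "x \<in> space N" for x
    using p_nonneg[OF that] q_nonneg[OF that]
    by (simp_all add: f_def g_def power_mult_distrib power_divide distrib_right mult.commute[of "(Y x)\<^sup>2"])
  have fg: "f x * g x = p x * Y x - q x * Y x" if "x \<in> space N" for x
  proof (cases "p x + q x = 0")
    \<comment> \<open>Here \<open>g x\<close> is a division by zero, but \<open>f x\<close> vanishes
      and so does the right-hand side.\<close>
    case True
    then have "p x = 0" "q x = 0"
      using p_nonneg[OF that] q_nonneg[OF that] by auto
    then show ?thesis
      by (simp add: f_def)
  next
    case False
    then have "sqrt (p x + q x) \<noteq> 0"
      by simp
    then have "f x * g x = Y x * (p x - q x)"
      by (simp add: f_def g_def)
    then show ?thesis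
      by (simp add: algebra_simps)
  qed
  \<comment> \<open>The shift by \<open>m\<close> cancels because both measures have mass 1.\<close>
  have "d = (\<integral>x. Y x \<partial>P) - (\<integral>x. Y x \<partial>Q)"
    using X by (simp add: d Y_def prob_one)
  also have "\<dots> = (\<integral>x. p x * Y x - q x * Y x \<partial>N)"
    using YP YQ by (simp add: integral_P integral_Q)
  also have "\<dots> = (\<integral>x. f x * g x \<partial>N)"
    by (intro Bochner_Integration.integral_cong) (auto simp: fg)
  finally have "d\<^sup>2 = (\<integral>x. f x * g x \<partial>N)\<^sup>2"
    by simp
  also have "\<dots> \<le> (\<integral>x. (f x)\<^sup>2 \<partial>N) * (\<integral>x. (g x)\<^sup>2 \<partial>N)"
    using Y2P Y2Q integrable_triangular
    by (intro integral_Cauchy_Schwarz) (simp_all add: f2 g2 cong: Bochner_Integration.integrable_cong)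
  also have "(\<integral>x. (f x)\<^sup>2 \<partial>N) = (\<integral>x. p x * (Y x)\<^sup>2 + q x * (Y x)\<^sup>2 \<partial>N)"
    by (intro Bochner_Integration.integral_cong) (auto simp: f2)
  also have "\<dots> = vP + vQ + d\<^sup>2 / 2"
    using Y2P Y2Q EP EQ by (simp add: integral_P integral_Q)
  also have "(\<integral>x. (g x)\<^sup>2 \<partial>N) = triangular"
    unfolding triangular_def by (intro Bochner_Integration.integral_cong) (auto simp: g2)
  finally show ?thesis
    by (simp add: mult.commute)
qed

lemma mean_diff_sq_le_chi2:
  fixes X :: "'a \<Rightarrow> real"
  assumes [measurable]: "X \<in> borel_measurable N"
    and X: "integrable P X" "integrable Q X"
  shows "ereal (((\<integral>x. X x \<partial>P) - (\<integral>x. X x \<partial>Q))\<^sup>2)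
    \<le> times_top (chi2_divergence N p q) (ext_variance Q X)"
proof (cases "chi2_divergence N p q = \<infinity> \<or> ext_variance Q X = \<infinity>")
  case True
  \<comment> \<open>Both factors are nonnegative, so no product of infinity with a negative number
    arises; a zero factor is covered by the convention of \<open>times_top\<close>.\<close>
  then have "times_top (chi2_divergence N p q) (ext_variance Q X) = \<infinity>"
    using chi2_nonneg ext_variance_nonneg[of Q X] by (auto simp: times_top_def)
  then show ?thesis
    by simp
next
  case False
  then have fin: "chi2_divergence N p q \<noteq> \<infinity>" "ext_variance Q X \<noteq> \<infinity>"
    by auto
  interpret P: prob_space P by (rule P_prob)
  interpret Q: prob_space Q by (rule Q_prob)
  have prob_one: "P.prob (space N) = 1" "Q.prob (space N) = 1"
    using P.prob_space Q.prob_space by simp_all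
  define Y where "Y x = X x - (\<integral>x. X x \<partial>Q)" for x
  have [measurable]: "Y \<in> borel_measurable N"
    unfolding Y_def by measurable
  have Y2: "integrable Q (\<lambda>x. (Y x)\<^sup>2)" and var: "ext_variance Q X = ereal (\<integral>x. (Y x)\<^sup>2 \<partial>Q)"
    using Q.ext_variance_finite_imp[OF X(2) fin(2), of "\<integral>x. X x \<partial>Q"] by (simp_all add: Y_def)
  have YP: "integrable N (\<lambda>x. p x * Y x)" and YQ: "integrable N (\<lambda>x. q x * Y x)"
    using X by (simp_all add: Y_def flip: integrable_P_iff integrable_Q_iff)
  define g where "g x = p x / q x - 1" for x
  have [measurable]: "g \<in> borel_measurable N"
    unfolding g_def by measurable
  note chi = chi2_finite[OF fin(1), folded g_def]
  have g2: "integrable Q (\<lambda>x. (g x)\<^sup>2)"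
    using chi(2) by (simp add: integrable_Q_iff mult.commute)
  have "(\<integral>x. X x \<partial>P) - (\<integral>x. X x \<partial>Q) = (\<integral>x. Y x \<partial>P) - (\<integral>x. Y x \<partial>Q)"
    using X by (simp add: Y_def prob_one)
  also have "\<dots> = (\<integral>x. p x * Y x - q x * Y x \<partial>N)"
    using YP YQ by (simp add: integral_P integral_Q)
  \<comment> \<open>The identity \<open>p - q = q g\<close> can fail only where
    \<open>q = 0 < p\<close>, a null set by absolute continuity.\<close>
  also have "\<dots> = (\<integral>x. q x * (g x * Y x) \<partial>N)"
    using AE_absolutely_continuous[OF chi(1)]
    by (intro integral_cong_AE) (auto simp: g_def algebra_simps elim!: eventually_mono)
  also have "\<dots> = (\<integral>x. g x * Y x \<partial>Q)"
    by (simp add: integral_Q)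
  finally have "((\<integral>x. X x \<partial>P) - (\<integral>x. X x \<partial>Q))\<^sup>2 = (\<integral>x. g x * Y x \<partial>Q)\<^sup>2"
    by simp
  also have "\<dots> \<le> (\<integral>x. (g x)\<^sup>2 \<partial>Q) * (\<integral>x. (Y x)\<^sup>2 \<partial>Q)"
    using g2 Y2 by (intro integral_Cauchy_Schwarz) auto
  also have "(\<integral>x. (g x)\<^sup>2 \<partial>Q) = (\<integral>x. (g x)\<^sup>2 * q x \<partial>N)"
    by (simp add: integral_Q mult.commute)
  finally show ?thesis
    by (simp add: times_top_def chi(3) var)
qed

end

section \<open>The four inequalities for the variances\<close>

theorem lemma2p1:
  fixes P Q N :: "'a measure" and p q X :: "'a \<Rightarrow> real"
  assumes "prob_space P" and "prob_space Q" and "sets Q = sets P"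
    and "p \<in> borel_measurable N" and "\<And>x. x \<in> space N \<Longrightarrow> 0 \<le> p x" and "P = density N (\<lambda>x. ennreal (p x))"
    and "q \<in> borel_measurable N" and "\<And>x. x \<in> space N \<Longrightarrow> 0 \<le> q x" and "Q = density N (\<lambda>x. ennreal (q x))"
    and "X \<in> borel_measurable P" and "integrable P X" and "integrable Q X"
  shows
    "let d = (\<integral>x. X x \<partial>P) - (\<integral>x. X x \<partial>Q);
         TV = total_variation N p q; H = hellinger N p q;
         KL_PQ = kl_divergence N p q; KL_QP = kl_divergence N q p;
         chi2_PQ = chi2_divergence N p q; chi2_QP = chi2_divergence N q p
     in
       ereal (if TV = 0 then 0 else d\<^sup>2 / 2 * (1 / TV - 1))
         \<le> ext_variance P X + ext_variance Q X \<and>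
       ereal (if H = 0 then 0 else d\<^sup>2 / (4 - 2 * H\<^sup>2) * (1 / H - H)\<^sup>2)
         \<le> ext_variance P X + ext_variance Q X \<and>
       (if KL_PQ = 0 \<or> KL_QP = 0 then 0 else ereal (d\<^sup>2) * (1 / (KL_PQ + KL_QP) - 1 / 4))
         \<le> max (ext_variance P X) (ext_variance Q X) \<and>
       (if chi2_QP = 0 \<or> chi2_PQ = 0 then 0 else ereal (d\<^sup>2))
         \<le> min (times_top chi2_QP (ext_variance P X)) (times_top chi2_PQ (ext_variance Q X))"
proof -
  interpret pq: density_pair N p q
    by (rule density_pair.intro) (simp_all add: assms(4,5,7,8) assms(1,2)[unfolded assms(6,9)])
  interpret qp: density_pair N q p
    by (rule pq.swap)
  have X [measurable]: "X \<in> borel_measurable N"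
    using assms(6,10) by simp
  define d where "d = (\<integral>x. X x \<partial>P) - (\<integral>x. X x \<partial>Q)"
  define TV where "TV = total_variation N p q"
  define H where "H = hellinger N p q"
  define h where "h = hellinger_sq N p q"
  define K where "K = kl_divergence N p q + kl_divergence N q p"
  have Hh: "H\<^sup>2 = h" "0 \<le> h" "h \<le> 1"
    using pq.hellinger_sq_nonneg pq.hellinger_sq_le_1 by (simp_all add: H_def h_def hellinger_def)
  have nonneg: "0 \<le> ext_variance P X" "0 \<le> ext_variance Q X"
    by (rule ext_variance_nonneg)+
  \<comment> \<open>The bracket is nonnegative, so \<open>triangular\<close> may be replaced by any
    upper bound \<open>c\<close>. The first three inequalities use \<open>2 TV\<close>,
    \<open>2 h (2 - h)\<close> and half the sum of the two Kullback--Leibler divergences.\<close>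
  have core: "d\<^sup>2 \<le> c * (vP + vQ + d\<^sup>2 / 2)"
    if "pq.triangular \<le> c" "ext_variance P X = ereal vP" "ext_variance Q X = ereal vQ" for c vP vQ
  proof -
    have "d\<^sup>2 \<le> pq.triangular * (vP + vQ + d\<^sup>2 / 2)"
      using pq.mean_diff_sq_le_triangular[of X vP vQ d] assms that by (simp add: d_def)
    also have "\<dots> \<le> c * (vP + vQ + d\<^sup>2 / 2)"
      using nonneg that by (intro mult_right_mono add_nonneg_nonneg) auto
    finally show ?thesis .
  qed
  have cases_var: "ext_variance P X = \<infinity> \<or> ext_variance Q X = \<infinity> \<or>
      (\<exists>vP vQ. ext_variance P X = ereal vP \<and> ext_variance Q X = ereal vQ)"
    by (auto simp: ext_variance_def)

  \<comment> \<open>Total variation\<close>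
  have "ereal (if TV = 0 then 0 else d\<^sup>2 / 2 * (1 / TV - 1)) \<le> ext_variance P X + ext_variance Q X"
  proof (cases "TV = 0 \<or> ext_variance P X = \<infinity> \<or> ext_variance Q X = \<infinity>")
    case True
    then show ?thesis
      using nonneg by (auto simp: zero_ereal_def[symmetric])
  next
    case False
    then obtain vP vQ where v: "ext_variance P X = ereal vP" "ext_variance Q X = ereal vQ"
      using cases_var by auto
    have "TV > 0"
      using False pq.triangular_nonneg pq.triangular_le_TV by (simp add: TV_def)
    have "d\<^sup>2 \<le> 2 * TV * (vP + vQ + d\<^sup>2 / 2)"
      using pq.triangular_le_TV v by (intro core) (auto simp: TV_def)
    then have "d\<^sup>2 / 2 * (1 / TV - 1) \<le> vP + vQ"
      using \<open>TV > 0\<close> by (simp add: field_simps)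
    then show ?thesis
      using False v by simp
  qed

  \<comment> \<open>Hellinger distance\<close>
  moreover have "ereal (if H = 0 then 0 else d\<^sup>2 / (4 - 2 * H\<^sup>2) * (1 / H - H)\<^sup>2)
      \<le> ext_variance P X + ext_variance Q X"
  proof (cases "H = 0 \<or> ext_variance P X = \<infinity> \<or> ext_variance Q X = \<infinity>")
    case True
    then show ?thesis
      using nonneg by (auto simp: zero_ereal_def[symmetric])
  next
    case False
    then obtain vP vQ where v: "ext_variance P X = ereal vP" "ext_variance Q X = ereal vQ"
      using cases_var by auto
    have "h > 0"
      using Hh False by (metis less_eq_real_def zero_eq_power2)
    define s where "s = 2 * h * (2 - h)"
    have "s > 0"
      using \<open>h > 0\<close> Hh by (simp add: s_def)
    have "d\<^sup>2 \<le> s * (vP + vQ + d\<^sup>2 / 2)"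
      using pq.triangular_le_hellinger v by (intro core) (auto simp: h_def s_def)
    then have le: "d\<^sup>2 / s \<le> vP + vQ + d\<^sup>2 / 2"
      using \<open>s > 0\<close> by (simp add: field_simps)
    have "(1 / H - H)\<^sup>2 = (1 - h)\<^sup>2 / h"
    proof -
      have "1 / H - H = (1 - h) / H"
        using False Hh by (simp add: field_simps power2_eq_square)
      then show ?thesis
        by (simp add: power_divide Hh)
    qed
    moreover have "d\<^sup>2 / (4 - 2 * h) * ((1 - h)\<^sup>2 / h) = d\<^sup>2 * (1 - h)\<^sup>2 / s"
      by (simp add: s_def algebra_simps)
    \<comment> \<open>This turns \<open>d^2 (1 - h)^2 / s\<close> into
      \<open>d^2 / s - d^2 / 2\<close>, the form in which \<open>le\<close> bounds it.\<close>
    moreover have "(1 - h)\<^sup>2 = 1 - s / 2"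
      by (simp add: s_def power2_eq_square field_simps)
    ultimately have "d\<^sup>2 / (4 - 2 * H\<^sup>2) * (1 / H - H)\<^sup>2 = d\<^sup>2 / s - d\<^sup>2 / 2"
      using \<open>s > 0\<close> Hh by (simp add: field_simps)
    then show ?thesis
      using False v le by simp
  qed

  \<comment> \<open>Symmetrized Kullback--Leibler divergence\<close>
  moreover have "(if kl_divergence N p q = 0 \<or> kl_divergence N q p = 0 then 0
      else ereal (d\<^sup>2) * (1 / K - 1 / 4)) \<le> max (ext_variance P X) (ext_variance Q X)"
  proof (cases "ext_variance P X = \<infinity> \<or> ext_variance Q X = \<infinity>")
    case True
    then show ?thesis by auto
  next
    case False
    then obtain vP vQ where v: "ext_variance P X = ereal vP" "ext_variance Q X = ereal vQ"
      using cases_var by auto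
    define M where "M = max vP vQ"
    have M: "0 \<le> M" "vP + vQ \<le> 2 * M" "max (ext_variance P X) (ext_variance Q X) = ereal M"
      using nonneg v by (auto simp: M_def max_def)
    \<comment> \<open>This is proved without the convention for zero divergences. For
      \<open>K = 0\<close> the term \<open>1 / K\<close> is infinite in \<open>ereal\<close>, but
      then \<open>d = 0\<close> and the product is 0.\<close>
    have "ereal (d\<^sup>2) * (1 / K - 1 / 4) \<le> ereal M"
    proof (cases "K = \<infinity>")
      case True
      have "- (d\<^sup>2 / 4) \<le> M"
        using M(1) by (rule order_trans[rotated]) simp
      then show ?thesis
        using True by (simp add: divide_ereal_def)
    next
      case K: False
      then have "kl_divergence N p q \<noteq> \<infinity>" "kl_divergence N q p \<noteq> \<infinity>"
        by (auto simp: K_def)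
      then obtain j where j: "K = ereal j" "2 * pq.triangular \<le> j"
        unfolding K_def by (rule pq.jeffreys_ge_triangular)
      have "d\<^sup>2 \<le> j / 2 * (vP + vQ + d\<^sup>2 / 2)"
        using j v by (intro core) auto
      show ?thesis
      proof (cases "j = 0")
        case True
        then have "d = 0"
          using \<open>d\<^sup>2 \<le> _\<close> by simp
        then show ?thesis
          using M(1) by (simp add: zero_ereal_def[symmetric])
      next
        case False
        then have "j > 0"
          using j(2) pq.triangular_nonneg by simp
        \<comment> \<open>The sum of the variances is at most twice their maximum; dividing by
          \<open>j\<close> then gives exactly the constant \<open>1 / 4\<close>.\<close>
        have "d\<^sup>2 \<le> j / 2 * (2 * M + d\<^sup>2 / 2)"
          using \<open>j > 0\<close> M(2)
          by (intro order_trans[OF \<open>d\<^sup>2 \<le> _\<close> mult_left_mono]) auto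
        then have "d\<^sup>2 * (1 / j - 1 / 4) \<le> M"
          using \<open>j > 0\<close> by (simp add: field_simps)
        then show ?thesis
          using \<open>j > 0\<close> by (simp add: j(1) one_ereal_def)
      qed
    qed
    then show ?thesis
      using M by (simp add: zero_ereal_def)
  qed

  \<comment> \<open>Chi-square divergence\<close>
  moreover have "(if chi2_divergence N q p = 0 \<or> chi2_divergence N p q = 0 then 0 else ereal (d\<^sup>2))
      \<le> min (times_top (chi2_divergence N q p) (ext_variance P X))
            (times_top (chi2_divergence N p q) (ext_variance Q X))"
  proof -
    \<comment> \<open>The roles of \<open>p\<close> and \<open>q\<close> are exchanged, which only
      changes the sign of \<open>d\<close>.\<close>
    have "ereal (d\<^sup>2) \<le> times_top (chi2_divergence N q p) (ext_variance P X)"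
      using qp.mean_diff_sq_le_chi2[of X] assms by (simp add: d_def power2_commute)
    moreover have "ereal (d\<^sup>2) \<le> times_top (chi2_divergence N p q) (ext_variance Q X)"
      using pq.mean_diff_sq_le_chi2[of X] assms by (simp add: d_def)
    ultimately have "ereal (d\<^sup>2) \<le> min (times_top (chi2_divergence N q p) (ext_variance P X))
        (times_top (chi2_divergence N p q) (ext_variance Q X))"
      by simp
    \<comment> \<open>Replacing \<open>d^2\<close> by 0 under the convention only lowers the
      left-hand side.\<close>
    then show ?thesis
      by (rule order_trans[rotated]) simp
  qed
  ultimately show ?thesis
    unfolding Let_def d_def TV_def H_def K_def by blast
qed

end
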